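(* Let $\mathcal H$ be a separable Hilbert space, $J$ a countable index set, $I=\{1,\dots,m\}$, and for each $i\in I$ let $F_i=\{f_{ij}\}_{j\in J}$ be a sequence in $\mathcal H$. The following conditions are equivalent: (i) The family $\{F_i\}_{i\in I}$ is a family of woven frames for $\mathcal H$. (ii) There exists $A>0$ such that for every partition $\{\sigma_i\}_{i\in I}$ of $J$ there exists a bounded linear operator $T:\bigoplus_{i\in I}\ell^2(\sigma_i)\to\mathcal H$ such that $T(u_{ij})=f_{ij}$ for all $j\in\sigma_i$, $i\in I$, and $A I_{\mathcal H}\le TT^*$, where $\{u_{ij}\}_{j\in\sigma_i,i\in I}$ is the standard orthonormal basis of $\bigoplus_{i\in I}\ell^2(\sigma_i)$.
   Context: A sequence $\{f_j\}_{j\in J}$ in $\mathcal H$ is a frame for $\mathcal H$ with lower and upper bounds $A,B>0$ if $A\|f\|^2\le\sum_{j\in J}|\langle f,f_j\rangle|^2\le B\|f\|^2$ for all $f\in\mathcal H$. A partition $\{\sigma_i\}_{i\in I}$ of $J$ is a family of pairwise disjoint (possibly empty) subsets of $J$ with union $J$. A family of frames $\{F_i=\{f_{ij}\}_{j\in J}\}_{i\in I}$ is woven if there are universal constants $A,B>0$ such that for every partition $\{\sigma_i\}_{i\in I}$ of $J$ the family $\{f_{ij}\}_{j\in\sigma_i,i\in I}$ is a frame for $\mathcal H$ with bounds $A$ and $B$. The Hilbert space $\bigoplus_{i\in I}\ell^2(\sigma_i)$ consists of all families $\{c_{ij}\}_{j\in\sigma_i,i\in I}$ of complex numbers with $\sum_{i\in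 I}\sum_{j\in\sigma_i}|c_{ij}|^2<\infty$, with inner product $\langle\{c_{ij}\},\{d_{ij}\}\rangle=\sum_{i\in I}\sum_{j\in\sigma_i}c_{ij}\overline{d_{ij}}$. $I_{\mathcal H}$ is the identity operator, and $\le$ is the usual order on self-adjoint operators. *)

theory Defs
  imports "HOL-Analysis.Analysis"
begin

(* Complex Hilbert spaces. The inner product is linear in the first argument. The real scalar
   multiplication, norm and topology are those of banach; the axioms scaleR_scaleC and
   norm_eq_sqrt_cinner tie them to the complex structure. *)
class chilbert_space = banach +
  fixes scaleC :: "complex \<Rightarrow> 'a \<Rightarrow> 'a"
    and cinner :: "'a \<Rightarrow> 'a \<Rightarrow> complex"
  assumes scaleC_add_right: "scaleC a (x + y) = scaleC a x + scaleC a y"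
    and scaleC_add_left: "scaleC (a + b) x = scaleC a x + scaleC b x"
    and scaleC_scaleC: "scaleC a (scaleC b x) = scaleC (a * b) x"
    and scaleC_one: "scaleC 1 x = x"
    and scaleR_scaleC: "scaleR r x = scaleC (complex_of_real r) x"
    and cinner_commute: "cinner x y = cnj (cinner y x)"
    and cinner_add_left: "cinner (x + y) z = cinner x z + cinner y z"
    and cinner_scaleC_left: "cinner (scaleC a x) y = a * cinner x y"
    and cinner_ge_zero: "0 \<le> Re (cinner x x)"
    and cinner_eq_zero_iff: "cinner x x = 0 \<longleftrightarrow> x = 0"
    and norm_eq_sqrt_cinner: "norm x = sqrt (Re (cinner x x))"

instantiation complex :: chilbert_space
begin
definition scaleC_complex :: "complex \<Rightarrow> complex \<Rightarrow> complex" where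
  "scaleC_complex a x = a * x"
definition cinner_complex :: "complex \<Rightarrow> complex \<Rightarrow> complex" where
  "cinner_complex x y = x * cnj y"
instance
  by standard
    (auto simp: scaleC_complex_def cinner_complex_def algebra_simps scaleR_conv_of_real
      cmod_def power2_eq_square)
end

(* Infinite sums of nonnegative reals are to be read in [0, \<infinity>]. Since infsum is 0 for
   non-summable families, finiteness (implied by the upper bound) is required explicitly. *)
definition frame_with_bounds ::
  "real \<Rightarrow> real \<Rightarrow> 'k set \<Rightarrow> ('k \<Rightarrow> 'h::chilbert_space) \<Rightarrow> bool" where
  "frame_with_bounds A B K g \<longleftrightarrow> 0 < A \<and> 0 < B \<and>
     (\<forall>x. (\<lambda>k. (cmod (cinner x (g k)))\<^sup>2) summable_on K \<and>
          A * (norm x)\<^sup>2 \<le> (\<Sum>\<^sub>\<infinity>k\<in>K. (cmod (cinner x (g k)))\<^sup>2) \<and>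
          (\<Sum>\<^sub>\<infinity>k\<in>K. (cmod (cinner x (g k)))\<^sup>2) \<le> B * (norm x)\<^sup>2)"

definition is_frame :: "'k set \<Rightarrow> ('k \<Rightarrow> 'h::chilbert_space) \<Rightarrow> bool" where
  "is_frame K g \<longleftrightarrow> (\<exists>A B. frame_with_bounds A B K g)"

(* The parts may be empty. *)
definition is_partition :: "'i set \<Rightarrow> 'j set \<Rightarrow> ('i \<Rightarrow> 'j set) \<Rightarrow> bool" where
  "is_partition I J \<sigma> \<longleftrightarrow> disjoint_family_on \<sigma> I \<and> (\<Union>i\<in>I. \<sigma> i) = J"

definition woven_frames :: "'i set \<Rightarrow> 'j set \<Rightarrow> ('i \<Rightarrow> 'j \<Rightarrow> 'h::chilbert_space) \<Rightarrow> bool" where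
  "woven_frames I J f \<longleftrightarrow> (\<forall>i\<in>I. is_frame J (f i)) \<and>
     (\<exists>A>0. \<exists>B>0. \<forall>\<sigma>. is_partition I J \<sigma> \<longrightarrow>
        frame_with_bounds A B (SIGMA i:I. \<sigma> i) (\<lambda>(i, j). f i j))"

(* The Hilbert space direct sum of the spaces l^2(\<sigma> i), i \<in> I, for finite I. Families
   indexed by {(i, j). i \<in> I, j \<in> \<sigma> i} are represented by their extensions by zero. *)
definition l2_sum :: "'i set \<Rightarrow> ('i \<Rightarrow> 'j set) \<Rightarrow> ('i \<Rightarrow> 'j \<Rightarrow> complex) set" where
  "l2_sum I \<sigma> = {c. (\<forall>i j. \<not> (i \<in> I \<and> j \<in> \<sigma> i) \<longrightarrow> c i j = 0) \<and>
                     (\<forall>i\<in>I. (\<lambda>j. (cmod (c i j))\<^sup>2) summable_on \<sigma> i)}"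

definition l2_inner ::
  "'i set \<Rightarrow> ('i \<Rightarrow> 'j set) \<Rightarrow> ('i \<Rightarrow> 'j \<Rightarrow> complex) \<Rightarrow> ('i \<Rightarrow> 'j \<Rightarrow> complex) \<Rightarrow> complex" where
  "l2_inner I \<sigma> c d = (\<Sum>i\<in>I. \<Sum>\<^sub>\<infinity>j\<in>\<sigma> i. c i j * cnj (d i j))"

definition l2_norm :: "'i set \<Rightarrow> ('i \<Rightarrow> 'j set) \<Rightarrow> ('i \<Rightarrow> 'j \<Rightarrow> complex) \<Rightarrow> real" where
  "l2_norm I \<sigma> c = sqrt (Re (l2_inner I \<sigma> c c))"

definition l2_basis :: "'i \<Rightarrow> 'j \<Rightarrow> 'i \<Rightarrow> 'j \<Rightarrow> complex" where
  "l2_basis i j = (\<lambda>i' j'. if i' = i \<and> j' = j then 1 else 0)"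

(* Bounded complex-linear operators from l2_sum I \<sigma> to 'h; only the values of T on
   l2_sum I \<sigma> matter. *)
definition l2_bounded_operator ::
  "'i set \<Rightarrow> ('i \<Rightarrow> 'j set) \<Rightarrow> (('i \<Rightarrow> 'j \<Rightarrow> complex) \<Rightarrow> 'h::chilbert_space) \<Rightarrow> bool" where
  "l2_bounded_operator I \<sigma> T \<longleftrightarrow>
     (\<forall>c\<in>l2_sum I \<sigma>. \<forall>d\<in>l2_sum I \<sigma>. T (\<lambda>i j. c i j + d i j) = T c + T d) \<and>
     (\<forall>a. \<forall>c\<in>l2_sum I \<sigma>. T (\<lambda>i j. a * c i j) = scaleC a (T c)) \<and>
     (\<exists>K. \<forall>c\<in>l2_sum I \<sigma>. norm (T c) \<le> K * l2_norm I \<sigma> c)"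

(* Hilbert space adjoint of a bounded operator T from l2_sum I \<sigma> to 'h; unique because
   elements of l2_sum I \<sigma> vanish off the index set. *)
definition l2_adjoint ::
  "'i set \<Rightarrow> ('i \<Rightarrow> 'j set) \<Rightarrow> (('i \<Rightarrow> 'j \<Rightarrow> complex) \<Rightarrow> 'h::chilbert_space)
     \<Rightarrow> 'h \<Rightarrow> 'i \<Rightarrow> 'j \<Rightarrow> complex" where
  "l2_adjoint I \<sigma> T = (THE S. (\<forall>x. S x \<in> l2_sum I \<sigma>) \<and>
     (\<forall>c\<in>l2_sum I \<sigma>. \<forall>x. cinner (T c) x = l2_inner I \<sigma> c (S x)))"

definition selfadjoint_operator :: "('h::chilbert_space \<Rightarrow> 'h) \<Rightarrow> bool" where
  "selfadjoint_operator P \<longleftrightarrow>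
     bounded_linear P \<and> (\<forall>a x. P (scaleC a x) = scaleC a (P x)) \<and>
     (\<forall>x y. cinner (P x) y = cinner x (P y))"

(* The quadratic forms of self-adjoint operators are real-valued. *)
definition operator_le :: "('h::chilbert_space \<Rightarrow> 'h) \<Rightarrow> ('h \<Rightarrow> 'h) \<Rightarrow> bool" where
  "operator_le P Q \<longleftrightarrow> selfadjoint_operator P \<and> selfadjoint_operator Q \<and>
     (\<forall>x. Re (cinner (P x) x) \<le> Re (cinner (Q x) x))"

end

theory Submission
  imports Defs
begin

text \<open>
  A bounded operator with \<open>T (u\<^sub>i\<^sub>j) = f\<^sub>i\<^sub>j\<close> forces the family \<open>f\<close> to be Bessel, and by density of the
  finitely supported sequences it is the synthesis operator of \<open>f\<close>. Hence its adjoint is the analysis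
  operator, and \<open>A I \<le> T T*\<close> says precisely that \<open>A\<close> is a lower frame bound; conversely, every Bessel
  family has a bounded synthesis operator. Condition (ii) does not ask for a common norm bound on the
  operators: the partition whose \<open>i\<close>-th part is all of \<open>J\<close> gives a Bessel bound for each single
  \<open>F\<^sub>i\<close>, and the sum of these finitely many bounds works for every partition.
\<close>

section \<open>Complex inner products\<close>

lemma cinner_add_right: "cinner x (y + z) = cinner x y + cinner x (z :: 'h::chilbert_space)"
  by (metis cinner_add_left cinner_commute complex_cnj_add)

lemma cinner_scaleC_right: "cinner x (scaleC a y) = cnj a * cinner x (y :: 'h::chilbert_space)"
  by (metis cinner_commute cinner_scaleC_left complex_cnj_mult)

lemma cinner_zero_right [simp]: "cinner (x :: 'h::chilbert_space) 0 = 0"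
  using cinner_add_right[of x 0 0] by simp

lemma cinner_sum_right: "cinner (x :: 'h::chilbert_space) (sum g F) = (\<Sum>k\<in>F. cinner x (g k))"
  by (induction F rule: infinite_finite_induct) (simp_all add: cinner_add_right)

text \<open>The norm axiom only controls the real part; the imaginary part vanishes because
  conjugate symmetry makes \<open>cinner x x\<close> equal to its own conjugate.\<close>

lemma cinner_self: "cinner x x = complex_of_real ((norm (x :: 'h::chilbert_space))\<^sup>2)"
proof (rule complex_eqI)
  show "Im (cinner x x) = Im (complex_of_real ((norm x)\<^sup>2))"
    using arg_cong[OF cinner_commute[of x x], of Im] by simp
qed (simp add: norm_eq_sqrt_cinner cinner_ge_zero)

lemma norm_scaleC: "norm (scaleC a x) = cmod a * norm (x :: 'h::chilbert_space)"
proof -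
  have "complex_of_real ((norm (scaleC a x))\<^sup>2) = complex_of_real ((cmod a * norm x)\<^sup>2)"
    unfolding cinner_self[symmetric] cinner_scaleC_left cinner_scaleC_right
    by (simp add: cinner_self power_mult_distrib complex_norm_square[symmetric]
        mult.commute[of "cnj a"] flip: mult.assoc)
  then show ?thesis
    by (simp only: of_real_eq_iff power2_eq_iff_nonneg norm_ge_zero mult_nonneg_nonneg)
qed

lemma scaleC_zero_left [simp]: "scaleC 0 (x :: 'h::chilbert_space) = 0"
  using norm_scaleC[of 0 x] by simp

lemma scaleR_scaleC_commute:
  "scaleC a (r *\<^sub>R x) = r *\<^sub>R scaleC a (x :: 'h::chilbert_space)"
  by (simp add: scaleR_scaleC scaleC_scaleC mult.commute)

lemma cinner_scaleR_left: "cinner (r *\<^sub>R x) y = of_real r * cinner x (y :: 'h::chilbert_space)"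
  by (simp add: scaleR_scaleC cinner_scaleC_left)

lemma cinner_scaleR_right: "cinner x (r *\<^sub>R y) = of_real r * cinner x (y :: 'h::chilbert_space)"
  by (simp add: scaleR_scaleC cinner_scaleC_right)

lemma cinner_Cauchy_Schwarz: "cmod (cinner x y) \<le> norm x * norm (y :: 'h::chilbert_space)"
proof (cases "y = 0")
  case False
  define n where "n = (norm y)\<^sup>2"
  \<comment> \<open>This coefficient makes \<open>x + scaleC a y\<close> the component of
    \<open>x\<close> orthogonal to \<open>y\<close>; nonnegativity of its squared norm is the
    inequality divided by \<open>n\<close>.\<close>
  define a where "a = - (cinner x y / of_real n)"
  have n: "n > 0" using False by (simp add: n_def)
  have "cinner (x + scaleC a y) (x + scaleC a y)
      = cinner x x + cnj a * cinner x y + a * cnj (cinner x y) + a * cnj a * of_real n"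
    using cinner_commute[of y x] cinner_self[of y]
    by (simp add: cinner_add_left cinner_add_right cinner_scaleC_left cinner_scaleC_right
        n_def algebra_simps)
  also have "\<dots> = cinner x x - cinner x y * cnj (cinner x y) / of_real n"
    using n by (simp add: a_def field_simps)
  also have "\<dots> = of_real ((norm x)\<^sup>2 - (cmod (cinner x y))\<^sup>2 / n)"
    by (simp add: cinner_self complex_norm_square[symmetric])
  finally have "0 \<le> Re (of_real ((norm x)\<^sup>2 - (cmod (cinner x y))\<^sup>2 / n))"
    by (metis cinner_ge_zero)
  then have "(cmod (cinner x y))\<^sup>2 \<le> (norm x * norm y)\<^sup>2"
    using n by (simp add: field_simps power_mult_distrib n_def)
  then show ?thesis
    by (rule power2_le_imp_le) simp
qed simp

lemma bounded_linear_cinner_left: "bounded_linear (\<lambda>x. cinner x (y :: 'h::chilbert_space))"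
  by (rule bounded_linear_intro[of _ "norm y"])
    (auto simp: cinner_add_left cinner_scaleR_left cinner_Cauchy_Schwarz scaleR_conv_of_real)

section \<open>Synthesis operators of Bessel families\<close>

text \<open>Finite partial sums keep summability out of the hypothesis. \<open>C\<close> is the
  square root of the usual Bessel constant, so that it is also the norm bound of the synthesis
  operator.\<close>

definition bessel_bound :: "real \<Rightarrow> 'k set \<Rightarrow> ('k \<Rightarrow> 'h::chilbert_space) \<Rightarrow> bool" where
  "bessel_bound C K g \<longleftrightarrow> 0 \<le> C \<and>
     (\<forall>F x. finite F \<and> F \<subseteq> K \<longrightarrow> (\<Sum>k\<in>F. (cmod (cinner x (g k)))\<^sup>2) \<le> (C * norm x)\<^sup>2)"

lemma bessel_bound_summable:
  assumes "bessel_bound C K g"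
  shows "(\<lambda>k. (cmod (cinner x (g k)))\<^sup>2) summable_on K"
    and "(\<Sum>\<^sub>\<infinity>k\<in>K. (cmod (cinner x (g k)))\<^sup>2) \<le> (C * norm x)\<^sup>2"
proof -
  show s: "(\<lambda>k. (cmod (cinner x (g k)))\<^sup>2) summable_on K"
    using assms unfolding bessel_bound_def
    by (intro nonneg_bdd_above_summable_on) (auto intro!: bdd_aboveI[of _ "(C * norm x)\<^sup>2"])
  show "(\<Sum>\<^sub>\<infinity>k\<in>K. (cmod (cinner x (g k)))\<^sup>2) \<le> (C * norm x)\<^sup>2"
    using assms unfolding bessel_bound_def by (intro infsum_le_finite_sums[OF s]) auto
qed

lemma frame_with_bounds_imp_bessel:
  assumes "frame_with_bounds A B K g"
  shows "bessel_bound (sqrt B) K g"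
  unfolding bessel_bound_def
proof (intro conjI allI impI)
  show "0 \<le> sqrt B"
    using assms by (auto simp: frame_with_bounds_def)
  fix F and x :: 'b
  assume F: "finite F \<and> F \<subseteq> K"
  have "(\<Sum>k\<in>F. (cmod (cinner x (g k)))\<^sup>2) \<le> (\<Sum>\<^sub>\<infinity>k\<in>K. (cmod (cinner x (g k)))\<^sup>2)"
    using assms F unfolding frame_with_bounds_def by (intro finite_sum_le_infsum) auto
  also have "\<dots> \<le> B * (norm x)\<^sup>2"
    using assms unfolding frame_with_bounds_def by auto
  also have "\<dots> = (sqrt B * norm x)\<^sup>2"
    using assms unfolding frame_with_bounds_def by (simp add: power_mult_distrib)
  finally show "(\<Sum>k\<in>F. (cmod (cinner x (g k)))\<^sup>2) \<le> (sqrt B * norm x)\<^sup>2" .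
qed

text \<open>Duality: pair the combination \<open>v\<close> with itself and expand only the second
  argument. Cauchy-Schwarz on the coefficients, followed by the Bessel inequality at
  \<open>v\<close>, leaves a factor \<open>norm v\<close> to cancel.\<close>

lemma bessel_bound_sum_le:
  assumes "bessel_bound C K g" "finite F" "F \<subseteq> K"
  shows "norm (\<Sum>k\<in>F. scaleC (c k) (g k)) \<le> C * L2_set (\<lambda>k. cmod (c k)) F"
proof -
  define v where "v = (\<Sum>k\<in>F. scaleC (c k) (g k))"
  have "(norm v)\<^sup>2 = cmod (cinner v v)"
    by (simp add: cinner_self norm_power)
  also have "cinner v v = (\<Sum>k\<in>F. cnj (c k) * cinner v (g k))"
    by (subst (2) v_def) (simp add: cinner_sum_right cinner_scaleC_right)
  also have "cmod \<dots> \<le> (\<Sum>k\<in>F. \<bar>cmod (c k)\<bar> * \<bar>cmod (cinner v (g k))\<bar>)"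
    by (rule sum_norm_le) (simp add: norm_mult)
  also have "\<dots> \<le> L2_set (\<lambda>k. cmod (c k)) F * L2_set (\<lambda>k. cmod (cinner v (g k))) F"
    by (rule L2_set_mult_ineq)
  also have "\<dots> \<le> L2_set (\<lambda>k. cmod (c k)) F * (C * norm v)"
    using assms unfolding bessel_bound_def
    by (intro mult_left_mono real_le_lsqrt L2_set_nonneg)
      (auto simp: L2_set_def intro!: real_le_lsqrt sum_nonneg)
  finally have "norm v * norm v \<le> (C * L2_set (\<lambda>k. cmod (c k)) F) * norm v"
    by (simp add: power2_eq_square algebra_simps)
  then have "norm v \<le> C * L2_set (\<lambda>k. cmod (c k)) F"
    using assms by (cases "v = 0") (auto simp: bessel_bound_def L2_set_nonneg)
  then show ?thesis by (simp add: v_def)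
qed

text \<open>The series need not converge absolutely, so the net of finite partial sums is shown to
  be Cauchy: two sums over \<open>F0\<close> and a larger \<open>F\<close> differ by a sum over
  \<open>F - F0\<close>, which is controlled by the tail of the square-summable
  coefficients.\<close>

lemma bessel_bound_synthesis_summable:
  assumes g: "bessel_bound C K g" and c: "(\<lambda>k. (cmod (c k))\<^sup>2) summable_on K"
  shows "(\<lambda>k. scaleC (c k) (g k)) summable_on K"
proof -
  define L where "L = (\<Sum>\<^sub>\<infinity>k\<in>K. (cmod (c k))\<^sup>2)"
  define S where "S F = (\<Sum>k\<in>F. scaleC (c k) (g k))" for F
  have C: "C \<ge> 0" using g by (simp add: bessel_bound_def)
  \<comment> \<open>The limit is 0; it is left as \<open>C * sqrt (L - L)\<close>, the form that the
    limit rules produce.\<close>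
  have lim: "((\<lambda>F. C * sqrt (L - (\<Sum>k\<in>F. (cmod (c k))\<^sup>2))) \<longlongrightarrow> C * sqrt (L - L)) (finite_subsets_at_top K)"
    using has_sum_infsum[OF c] unfolding has_sum_def L_def[symmetric]
    by (intro tendsto_intros)
  have tail: "norm (S F - S F0) \<le> C * sqrt (L - (\<Sum>k\<in>F0. (cmod (c k))\<^sup>2))"
    if "finite F" "F \<subseteq> K" "F0 \<subseteq> F" for F F0
  proof -
    have "S F - S F0 = S (F - F0)"
      using that by (simp add: S_def sum_diff)
    also have "norm \<dots> \<le> C * L2_set (\<lambda>k. cmod (c k)) (F - F0)"
      unfolding S_def by (rule bessel_bound_sum_le[OF g]) (use that in auto)
    also have "\<dots> \<le> C * sqrt (L - (\<Sum>k\<in>F0. (cmod (c k))\<^sup>2))"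
    proof -
      have "(\<Sum>k\<in>F - F0. (cmod (c k))\<^sup>2) = (\<Sum>k\<in>F. (cmod (c k))\<^sup>2) - (\<Sum>k\<in>F0. (cmod (c k))\<^sup>2)"
        using that by (simp add: sum_diff)
      moreover have "(\<Sum>k\<in>F. (cmod (c k))\<^sup>2) \<le> L"
        unfolding L_def by (rule finite_sum_le_infsum[OF c]) (use that in auto)
      ultimately show ?thesis
        unfolding L2_set_def using C by (intro mult_left_mono) auto
    qed
    finally show ?thesis .
  qed
  have "cauchy_filter (filtermap S (finite_subsets_at_top K))"
    unfolding cauchy_filter_metric_filtermap
  proof (intro allI impI)
    fix e :: real assume e: "e > 0"
    have "\<forall>\<^sub>F F in finite_subsets_at_top K. C * sqrt (L - (\<Sum>k\<in>F. (cmod (c k))\<^sup>2)) < e / 2"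
      using order_tendstoD(2)[OF lim, of "e / 2"] e by simp
    then obtain F0 where F0: "finite F0" "F0 \<subseteq> K"
        "C * sqrt (L - (\<Sum>k\<in>F0. (cmod (c k))\<^sup>2)) < e / 2"
      unfolding eventually_finite_subsets_at_top by blast
    define P where "P F \<longleftrightarrow> finite F \<and> F \<subseteq> K \<and> F0 \<subseteq> F" for F
    have "eventually P (finite_subsets_at_top K)"
      unfolding eventually_finite_subsets_at_top P_def using F0 by blast
    moreover have "dist (S F) (S F') < e" if "P F \<and> P F'" for F F'
    proof -
      have "dist (S F) (S F0) < e / 2" "dist (S F') (S F0) < e / 2"
        using that tail[of F F0] tail[of F' F0] F0(3) by (auto simp: P_def dist_norm)
      then show ?thesis by (rule dist_triangle_half_l)
    qed
    ultimately show "\<exists>P. eventually P (finite_subsets_at_top K) \<and>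
        (\<forall>F F'. P F \<and> P F' \<longrightarrow> dist (S F) (S F') < e)"
      by blast
  qed
  \<comment> \<open>The partial sums form a net indexed by finite sets, not a sequence, so
    completeness is needed in its filter form.\<close>
  moreover have "complete (UNIV :: 'b set)"
    by (meson Cauchy_convergent UNIV_I complete_def convergent_def)
  ultimately obtain l where "(S \<longlongrightarrow> l) (finite_subsets_at_top K)"
    using complete_uniform[where S = "UNIV :: 'b set"] by (force simp: filterlim_def)
  then show ?thesis
    unfolding summable_on_def has_sum_def S_def by blast
qed

lemma bessel_bound_synthesis_norm_le:
  assumes g: "bessel_bound C K g" and c: "(\<lambda>k. (cmod (c k))\<^sup>2) summable_on K"
  shows "norm (\<Sum>\<^sub>\<infinity>k\<in>K. scaleC (c k) (g k)) \<le> C * sqrt (\<Sum>\<^sub>\<infinity>k\<in>K. (cmod (c k))\<^sup>2)"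
proof -
  have "((\<lambda>F. norm (\<Sum>k\<in>F. scaleC (c k) (g k))) \<longlongrightarrow> norm (\<Sum>\<^sub>\<infinity>k\<in>K. scaleC (c k) (g k)))
      (finite_subsets_at_top K)"
    using has_sum_infsum[OF bessel_bound_synthesis_summable[OF g c]]
    unfolding has_sum_def by (rule tendsto_norm)
  moreover have "\<forall>\<^sub>F F in finite_subsets_at_top K. norm (\<Sum>k\<in>F. scaleC (c k) (g k))
      \<le> C * sqrt (\<Sum>\<^sub>\<infinity>k\<in>K. (cmod (c k))\<^sup>2)"
  proof (rule eventually_finite_subsets_at_top_weakI)
    fix F assume F: "finite F" "F \<subseteq> K"
    have "L2_set (\<lambda>k. cmod (c k)) F \<le> sqrt (\<Sum>\<^sub>\<infinity>k\<in>K. (cmod (c k))\<^sup>2)"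
      unfolding L2_set_def by (simp add: finite_sum_le_infsum[OF c] F)
    then show "norm (\<Sum>k\<in>F. scaleC (c k) (g k)) \<le> C * sqrt (\<Sum>\<^sub>\<infinity>k\<in>K. (cmod (c k))\<^sup>2)"
      using bessel_bound_sum_le[OF g F, of c] g unfolding bessel_bound_def
      by (meson mult_left_mono order_trans)
  qed
  ultimately show ?thesis
    using tendsto_upperbound finite_subsets_at_top_neq_bot by blast
qed

section \<open>Flattening the direct sum\<close>

text \<open>Finiteness of \<open>I\<close> makes summability on every part equivalent to summability
  on the disjoint union, so that the direct sum can be treated as a single sequence space over
  \<open>Sigma I \<sigma>\<close>.\<close>

lemma l2_sum_iff:
  assumes "finite I"
  shows "c \<in> l2_sum I \<sigma> \<longleftrightarrow>
    (\<forall>i j. (i, j) \<notin> Sigma I \<sigma> \<longrightarrow> c i j = 0) \<and>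
    (\<lambda>(i, j). (cmod (c i j))\<^sup>2) summable_on Sigma I \<sigma>"
proof -
  have "(\<forall>i\<in>I. (\<lambda>j. (cmod (c i j))\<^sup>2) summable_on \<sigma> i) \<longleftrightarrow>
      (\<lambda>(i, j). (cmod (c i j))\<^sup>2) summable_on Sigma I \<sigma>" (is "?L \<longleftrightarrow> ?R")
  proof
    assume L: ?L
    show ?R
    proof (rule summable_on_SigmaI)
      fix i assume "i \<in> I"
      then show "((\<lambda>j. case (i, j) of (i, j) \<Rightarrow> (cmod (c i j))\<^sup>2) has_sum
          (\<Sum>\<^sub>\<infinity>j\<in>\<sigma> i. (cmod (c i j))\<^sup>2)) (\<sigma> i)"
        using L by (auto intro: has_sum_infsum)
    qed (use assms in auto)
  qed (auto dest: summable_on_SigmaD1)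
  then show ?thesis
    unfolding l2_sum_def by auto
qed

text \<open>The products are absolutely summable since a * b is at most a^2 + b^2 for nonnegative a
  and b; this permits merging the iterated sum into one unordered sum.\<close>

lemma l2_inner_eq_infsum:
  assumes I: "finite I" and c: "c \<in> l2_sum I \<sigma>" and d: "d \<in> l2_sum I \<sigma>"
  shows "l2_inner I \<sigma> c d = (\<Sum>\<^sub>\<infinity>(i, j)\<in>Sigma I \<sigma>. c i j * cnj (d i j))"
proof -
  have "(\<lambda>(i, j). (cmod (c i j))\<^sup>2 + (cmod (d i j))\<^sup>2) summable_on Sigma I \<sigma>"
    using summable_on_add[of "\<lambda>(i, j). (cmod (c i j))\<^sup>2" "Sigma I \<sigma>" "\<lambda>(i, j). (cmod (d i j))\<^sup>2"]
      c d unfolding l2_sum_iff[OF I] by (simp add: case_prod_beta')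
  then have "(\<lambda>k. norm (case k of (i, j) \<Rightarrow> c i j * cnj (d i j))) summable_on Sigma I \<sigma>"
  proof (rule Infinite_Sum.abs_summable_on_comparison_test')
    fix k assume "k \<in> Sigma I \<sigma>"
    have "a * b \<le> a\<^sup>2 + b\<^sup>2" if "0 \<le> a" "0 \<le> b" for a b :: real
      using sum_squares_bound[of a b] mult_nonneg_nonneg[OF that] by simp
    then show "norm (case k of (i, j) \<Rightarrow> c i j * cnj (d i j))
        \<le> (case k of (i, j) \<Rightarrow> (cmod (c i j))\<^sup>2 + (cmod (d i j))\<^sup>2)"
      by (simp add: case_prod_beta norm_mult)
  qed
  then have "(\<lambda>(i, j). c i j * cnj (d i j)) summable_on Sigma I \<sigma>"
    by (rule abs_summable_summable)
  from infsum_Sigma'_banach[OF this] show ?thesis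
    using I by (simp add: l2_inner_def)
qed

lemma l2_norm_eq_infsum:
  assumes I: "finite I" and c: "c \<in> l2_sum I \<sigma>"
  shows "l2_norm I \<sigma> c = sqrt (\<Sum>\<^sub>\<infinity>(i, j)\<in>Sigma I \<sigma>. (cmod (c i j))\<^sup>2)"
proof -
  have "l2_inner I \<sigma> c c = (\<Sum>\<^sub>\<infinity>k\<in>Sigma I \<sigma>. complex_of_real (case k of (i, j) \<Rightarrow> (cmod (c i j))\<^sup>2))"
    unfolding l2_inner_eq_infsum[OF I c c]
    by (intro infsum_cong) (auto simp: complex_norm_square[symmetric])
  also have "\<dots> = complex_of_real (\<Sum>\<^sub>\<infinity>(i, j)\<in>Sigma I \<sigma>. (cmod (c i j))\<^sup>2)"
    using c I by (intro infsumI has_sum_of_real has_sum_infsum) (simp add: l2_sum_iff)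
  finally show ?thesis
    by (simp add: l2_norm_def)
qed

section \<open>Vector operations and truncations in the direct sum\<close>

lemma l2_sum_add:
  assumes c: "c \<in> l2_sum I \<sigma>" and d: "d \<in> l2_sum I \<sigma>"
  shows "(\<lambda>i j. c i j + d i j) \<in> l2_sum I \<sigma>"
proof -
  have "(\<lambda>j. (cmod (c i j + d i j))\<^sup>2) summable_on \<sigma> i" if "i \<in> I" for i
  proof (rule summable_on_comparison_test)
    show "(\<lambda>j. 2 * (cmod (c i j))\<^sup>2 + 2 * (cmod (d i j))\<^sup>2) summable_on \<sigma> i"
      using c d that unfolding l2_sum_def
      by (intro summable_on_add summable_on_cmult_right) auto
    fix j
    have "(cmod (c i j + d i j))\<^sup>2 \<le> (cmod (c i j) + cmod (d i j))\<^sup>2"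
      by (intro power_mono norm_triangle_ineq) simp
    also have "\<dots> \<le> 2 * (cmod (c i j))\<^sup>2 + 2 * (cmod (d i j))\<^sup>2"
      using sum_squares_bound[of "cmod (c i j)" "cmod (d i j)"]
      by (simp add: power2_sum)
    finally show "(cmod (c i j + d i j))\<^sup>2 \<le> 2 * (cmod (c i j))\<^sup>2 + 2 * (cmod (d i j))\<^sup>2" .
  qed simp
  then show ?thesis
    using c d unfolding l2_sum_def by auto
qed

lemma l2_sum_scale:
  assumes c: "c \<in> l2_sum I \<sigma>"
  shows "(\<lambda>i j. a * c i j) \<in> l2_sum I \<sigma>"
  using c unfolding l2_sum_def
  by (auto simp: norm_mult power_mult_distrib intro!: summable_on_cmult_right)

text \<open>Truncations to finite \<open>F\<close> are the finitely supported sequences, on which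
  linearity and the values on the basis determine an operator.\<close>

definition truncation :: "('i \<times> 'j) set \<Rightarrow> ('i \<Rightarrow> 'j \<Rightarrow> complex) \<Rightarrow> 'i \<Rightarrow> 'j \<Rightarrow> complex" where
  "truncation F c = (\<lambda>i j. if (i, j) \<in> F then c i j else 0)"

lemma truncation_has_sum:
  assumes "finite F" "F \<subseteq> K"
  shows "((\<lambda>(i, j). (cmod (truncation F c i j))\<^sup>2) has_sum (\<Sum>(i, j)\<in>F. (cmod (c i j))\<^sup>2)) K"
  using assms by (intro has_sum_finite_neutralI[of F]) (auto simp: truncation_def intro!: sum.cong)

lemma truncation_in_l2_sum:
  assumes "finite I" "finite F" "F \<subseteq> Sigma I \<sigma>"
  shows "truncation F c \<in> l2_sum I \<sigma>"
  unfolding l2_sum_iff[OF assms(1)]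
  using has_sum_imp_summable[OF truncation_has_sum[OF assms(2,3)]] assms(3)
  by (auto simp: truncation_def)

lemma l2_norm_truncation:
  assumes "finite I" "finite F" "F \<subseteq> Sigma I \<sigma>"
  shows "l2_norm I \<sigma> (truncation F c) = sqrt (\<Sum>(i, j)\<in>F. (cmod (c i j))\<^sup>2)"
  unfolding l2_norm_eq_infsum[OF assms(1) truncation_in_l2_sum[OF assms]]
  using infsumI[OF truncation_has_sum[OF assms(2,3)]] by simp

lemma l2_basis_eq_truncation: "l2_basis i j = truncation {(i, j)} (\<lambda>_ _. 1)"
  by (auto simp: l2_basis_def truncation_def fun_eq_iff)

text \<open>This measures how well truncations approximate \<open>c\<close>: truncation and
  remainder have disjoint supports, so their squared norms add up to that of \<open>c\<close>. The
  difference is written with the factor -1 to match the additivity and homogeneity clauses of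
  \<open>l2_bounded_operator\<close>.\<close>

lemma l2_norm_diff_truncation:
  assumes I: "finite I" and F: "finite F" "F \<subseteq> Sigma I \<sigma>" and c: "c \<in> l2_sum I \<sigma>"
  shows "(\<lambda>i j. c i j + (-1) * truncation F c i j) \<in> l2_sum I \<sigma>"
    and "l2_norm I \<sigma> (\<lambda>i j. c i j + (-1) * truncation F c i j)
      = sqrt ((\<Sum>\<^sub>\<infinity>(i, j)\<in>Sigma I \<sigma>. (cmod (c i j))\<^sup>2) - (\<Sum>(i, j)\<in>F. (cmod (c i j))\<^sup>2))"
proof -
  show d: "(\<lambda>i j. c i j + (-1) * truncation F c i j) \<in> l2_sum I \<sigma>"
    by (intro l2_sum_add l2_sum_scale truncation_in_l2_sum I F c)
  have "((\<lambda>(i, j). (cmod (c i j))\<^sup>2) has_sum (\<Sum>\<^sub>\<infinity>(i, j)\<in>Sigma I \<sigma>. (cmod (c i j))\<^sup>2)) (Sigma I \<sigma>)"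
    using c unfolding l2_sum_iff[OF I] by (intro has_sum_infsum) simp
  from has_sum_add[OF this has_sum_uminusI[OF truncation_has_sum[OF F, of c]]]
  have "((\<lambda>(i, j). (cmod (c i j + (-1) * truncation F c i j))\<^sup>2) has_sum
      ((\<Sum>\<^sub>\<infinity>(i, j)\<in>Sigma I \<sigma>. (cmod (c i j))\<^sup>2) - (\<Sum>(i, j)\<in>F. (cmod (c i j))\<^sup>2))) (Sigma I \<sigma>)"
    unfolding add_uminus_conv_diff
    by (rule has_sum_cong[THEN iffD1, rotated]) (auto simp: truncation_def)
  then show "l2_norm I \<sigma> (\<lambda>i j. c i j + (-1) * truncation F c i j)
      = sqrt ((\<Sum>\<^sub>\<infinity>(i, j)\<in>Sigma I \<sigma>. (cmod (c i j))\<^sup>2) - (\<Sum>(i, j)\<in>F. (cmod (c i j))\<^sup>2))"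
    unfolding l2_norm_eq_infsum[OF I d] by (simp add: infsumI)
qed

section \<open>Bounded operators with prescribed values on the standard basis\<close>

lemma bessel_bound_imp_operator:
  assumes I: "finite I" and f: "bessel_bound C (Sigma I \<sigma>) (\<lambda>(i, j). f i j)"
  defines "T \<equiv> (\<lambda>c. \<Sum>\<^sub>\<infinity>(i, j)\<in>Sigma I \<sigma>. scaleC (c i j) (f i j))"
  shows "l2_bounded_operator I \<sigma> T" and "\<forall>i\<in>I. \<forall>j\<in>\<sigma> i. T (l2_basis i j) = f i j"
proof -
  have sq: "(\<lambda>k. (cmod (case_prod c k))\<^sup>2) summable_on Sigma I \<sigma>" if "c \<in> l2_sum I \<sigma>" for c
    using that unfolding l2_sum_iff[OF I] by (simp add: case_prod_beta')
  have T: "T c = (\<Sum>\<^sub>\<infinity>k\<in>Sigma I \<sigma>. scaleC (case_prod c k) (case_prod f k))" for c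
    by (simp add: T_def case_prod_beta')
  \<comment> \<open>Recording genuine convergence, rather than the value of an infinite sum that
    defaults to 0, is what lets linearity pass to \<open>T\<close>.\<close>
  have has: "((\<lambda>k. scaleC (case_prod c k) (case_prod f k)) has_sum T c) (Sigma I \<sigma>)"
    if "c \<in> l2_sum I \<sigma>" for c
    unfolding T by (intro has_sum_infsum bessel_bound_synthesis_summable[OF f sq[OF that]])
  have "T (\<lambda>i j. c i j + d i j) = T c + T d" if "c \<in> l2_sum I \<sigma>" "d \<in> l2_sum I \<sigma>" for c d
    using has_sum_add[OF has[OF that(1)] has[OF that(2)]]
    by (subst T, intro infsumI) (simp add: scaleC_add_left case_prod_beta')
  moreover have "T (\<lambda>i j. a * c i j) = scaleC a (T c)" if "c \<in> l2_sum I \<sigma>" for a c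
  proof -
    have "bounded_linear (scaleC a :: 'c \<Rightarrow> 'c)"
      by (rule bounded_linear_intro[of _ "cmod a"])
        (auto simp: scaleC_add_right scaleR_scaleC_commute norm_scaleC)
    from has_sum_bounded_linear[OF this has[OF that]] show ?thesis
      by (subst T, intro infsumI) (simp add: scaleC_scaleC case_prod_beta')
  qed
  moreover have "norm (T c) \<le> C * l2_norm I \<sigma> c" if "c \<in> l2_sum I \<sigma>" for c
    using bessel_bound_synthesis_norm_le[OF f sq[OF that]]
    unfolding T l2_norm_eq_infsum[OF I that] by (simp add: case_prod_beta')
  ultimately show "l2_bounded_operator I \<sigma> T"
    unfolding l2_bounded_operator_def by blast
  show "\<forall>i\<in>I. \<forall>j\<in>\<sigma> i. T (l2_basis i j) = f i j"
  proof (intro ballI)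
    fix i j assume "i \<in> I" "j \<in> \<sigma> i"
    then have "((\<lambda>k. scaleC (case_prod (l2_basis i j) k) (case_prod f k)) has_sum f i j) (Sigma I \<sigma>)"
      by (intro has_sum_finite_neutralI[of "{(i, j)}"])
        (auto simp: l2_basis_def scaleC_one split: if_splits)
    then show "T (l2_basis i j) = f i j"
      unfolding T by (rule infsumI)
  qed
qed

text \<open>The candidate for the adjoint. Extension by zero off the index set is what membership in
  \<open>l2_sum\<close> requires.\<close>

definition analysis ::
  "'i set \<Rightarrow> ('i \<Rightarrow> 'j set) \<Rightarrow> ('i \<Rightarrow> 'j \<Rightarrow> 'h::chilbert_space) \<Rightarrow> 'h \<Rightarrow> 'i \<Rightarrow> 'j \<Rightarrow> complex" where
  "analysis I \<sigma> f x = (\<lambda>i j. if i \<in> I \<and> j \<in> \<sigma> i then cinner x (f i j) else 0)"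

section \<open>Recovering an operator and its adjoint from the values on the basis\<close>

locale l2_operator =
  fixes I :: "'i set" and \<sigma> :: "'i \<Rightarrow> 'j set" and T :: "('i \<Rightarrow> 'j \<Rightarrow> complex) \<Rightarrow> 'h::chilbert_space"
    and f :: "'i \<Rightarrow> 'j \<Rightarrow> 'h"
  assumes finite_I: "finite I"
    and bounded_operator: "l2_bounded_operator I \<sigma> T"
    and T_basis: "\<And>i j. i \<in> I \<Longrightarrow> j \<in> \<sigma> i \<Longrightarrow> T (l2_basis i j) = f i j"
begin

lemma T_add: "c \<in> l2_sum I \<sigma> \<Longrightarrow> d \<in> l2_sum I \<sigma> \<Longrightarrow> T (\<lambda>i j. c i j + d i j) = T c + T d"
  using bounded_operator unfolding l2_bounded_operator_def by blast

lemma T_scale: "c \<in> l2_sum I \<sigma> \<Longrightarrow> T (\<lambda>i j. a * c i j) = scaleC a (T c)"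
  using bounded_operator unfolding l2_bounded_operator_def by blast

text \<open>The constant in \<open>l2_bounded_operator\<close> carries no sign; its absolute value
  is also a bound, and later estimates multiply by it.\<close>

lemma T_bound: "\<exists>C\<ge>0. \<forall>c\<in>l2_sum I \<sigma>. norm (T c) \<le> C * l2_norm I \<sigma> c"
proof -
  obtain C where C: "\<And>c. c \<in> l2_sum I \<sigma> \<Longrightarrow> norm (T c) \<le> C * l2_norm I \<sigma> c"
    using bounded_operator unfolding l2_bounded_operator_def by blast
  have nonneg: "l2_norm I \<sigma> c \<ge> 0" if "c \<in> l2_sum I \<sigma>" for c
    unfolding l2_norm_eq_infsum[OF finite_I that] by (auto intro: infsum_nonneg)
  show ?thesis
  proof (intro exI[of _ "\<bar>C\<bar>"] conjI ballI)
    fix c assume c: "c \<in> l2_sum I \<sigma>"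
    show "norm (T c) \<le> \<bar>C\<bar> * l2_norm I \<sigma> c"
      using C[OF c] mult_right_mono[OF abs_ge_self[of C] nonneg[OF c]] by linarith
  qed simp
qed

lemma T_truncation:
  assumes "finite F" "F \<subseteq> Sigma I \<sigma>"
  shows "T (truncation F c) = (\<Sum>(i, j)\<in>F. scaleC (c i j) (f i j))"
  using assms
proof (induction F)
  case empty
  \<comment> \<open>The empty truncation is zero; writing it with the scalar 0 turns homogeneity
    into the vanishing of \<open>T\<close> at zero.\<close>
  have "T (\<lambda>i j. 0 * truncation {} c i j) = 0"
    by (subst T_scale) (auto intro: truncation_in_l2_sum finite_I)
  then show ?case by (simp add: truncation_def)
next
  case (insert k F)
  obtain i j where k: "k = (i, j)" by (cases k)
  have ij: "i \<in> I" "j \<in> \<sigma> i" and F: "F \<subseteq> Sigma I \<sigma>"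
    using insert.prems by (auto simp: k)
  have basis: "l2_basis i j \<in> l2_sum I \<sigma>"
    unfolding l2_basis_eq_truncation using ij by (intro truncation_in_l2_sum finite_I) auto
  have eq: "truncation (insert k F) c = (\<lambda>i' j'. truncation F c i' j' + c i j * l2_basis i j i' j')"
    using insert.hyps by (auto simp: truncation_def l2_basis_def fun_eq_iff k)
  have "T (truncation (insert k F) c) = T (truncation F c) + scaleC (c i j) (f i j)"
    unfolding eq
    by (simp add: l2_sum_scale[OF basis]
        T_add[OF truncation_in_l2_sum[OF finite_I insert.hyps(1) F]]
        T_scale[OF basis] T_basis[OF ij])
  then show ?case
    using insert.IH[OF F] insert.hyps by (simp add: k add.commute)
qed

text \<open>\<open>T\<close> is tested on the truncated coefficients of \<open>x\<close>. Pairing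
  the image with \<open>x\<close> gives exactly the partial sum \<open>s\<close>, while boundedness
  gives at most \<open>norm x * (C * sqrt s)\<close>; dividing by \<open>sqrt s\<close> yields the
  Bessel inequality.\<close>

lemma bessel: obtains C where "bessel_bound C (Sigma I \<sigma>) (\<lambda>(i, j). f i j)"
proof -
  obtain C where C: "C \<ge> 0" "\<And>c. c \<in> l2_sum I \<sigma> \<Longrightarrow> norm (T c) \<le> C * l2_norm I \<sigma> c"
    using T_bound by blast
  have "(\<Sum>(i, j)\<in>F. (cmod (cinner x (f i j)))\<^sup>2) \<le> (C * norm x)\<^sup>2"
    if F: "finite F" "F \<subseteq> Sigma I \<sigma>" for F x
  proof -
    define s where "s = (\<Sum>(i, j)\<in>F. (cmod (cinner x (f i j)))\<^sup>2)"
    define v where "v = T (truncation F (\<lambda>i j. cinner x (f i j)))"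
    have s: "s \<ge> 0" unfolding s_def by (auto intro: sum_nonneg)
    have "cinner x v = (\<Sum>(i, j)\<in>F. complex_of_real ((cmod (cinner x (f i j)))\<^sup>2))"
      unfolding v_def T_truncation[OF F] cinner_sum_right
      by (intro sum.cong)
        (auto simp: cinner_scaleC_right complex_norm_square[symmetric] mult.commute[of "cnj _"])
    also have "\<dots> = of_real s"
      by (simp add: s_def case_prod_beta')
    finally have "s = cmod (cinner x v)"
      using s by simp
    also have "\<dots> \<le> norm x * norm v"
      by (rule cinner_Cauchy_Schwarz)
    also have "\<dots> \<le> norm x * (C * sqrt s)"
      using C(2)[OF truncation_in_l2_sum[OF finite_I F], of "\<lambda>i j. cinner x (f i j)"]
      unfolding l2_norm_truncation[OF finite_I F] v_def s_def by (intro mult_left_mono) auto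
    finally have "sqrt s * sqrt s \<le> (C * norm x) * sqrt s"
      using s by (simp add: algebra_simps)
    then have "sqrt s \<le> C * norm x"
      using s C(1) by (cases "s = 0") (auto simp: mult_le_cancel_right simp del: real_sqrt_mult_self)
    then have "(sqrt s)\<^sup>2 \<le> (C * norm x)\<^sup>2"
      using s by (intro power_mono) auto
    then show ?thesis
      using s by (simp add: s_def)
  qed
  then show thesis
    using C(1) by (intro that[of C]) (auto simp: bessel_bound_def case_prod_beta')
qed

text \<open>Truncations of \<open>c\<close> converge to \<open>c\<close> in norm and
  \<open>T\<close> is bounded, so their images, which are the finite partial sums, converge to
  \<open>T c\<close>. Thus \<open>T\<close> can only be the synthesis operator.\<close>

lemma T_has_sum:
  assumes c: "c \<in> l2_sum I \<sigma>"
  shows "((\<lambda>(i, j). scaleC (c i j) (f i j)) has_sum T c) (Sigma I \<sigma>)"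
proof -
  obtain C where C: "\<And>c. c \<in> l2_sum I \<sigma> \<Longrightarrow> norm (T c) \<le> C * l2_norm I \<sigma> c"
    using T_bound by blast
  define L where "L = (\<Sum>\<^sub>\<infinity>(i, j)\<in>Sigma I \<sigma>. (cmod (c i j))\<^sup>2)"
  have "((\<lambda>F. C * sqrt (L - (\<Sum>(i, j)\<in>F. (cmod (c i j))\<^sup>2))) \<longlongrightarrow> C * sqrt (L - L))
      (finite_subsets_at_top (Sigma I \<sigma>))"
  proof -
    have "((\<lambda>(i, j). (cmod (c i j))\<^sup>2) has_sum L) (Sigma I \<sigma>)"
      using c unfolding l2_sum_iff[OF finite_I] L_def by (intro has_sum_infsum) simp
    then show ?thesis
      unfolding has_sum_def by (intro tendsto_intros)
  qed
  then have lim: "((\<lambda>F. C * sqrt (L - (\<Sum>(i, j)\<in>F. (cmod (c i j))\<^sup>2))) \<longlongrightarrow> 0)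
      (finite_subsets_at_top (Sigma I \<sigma>))" by simp
  have "\<forall>\<^sub>F F in finite_subsets_at_top (Sigma I \<sigma>).
      norm ((\<Sum>(i, j)\<in>F. scaleC (c i j) (f i j)) - T c) \<le> C * sqrt (L - (\<Sum>(i, j)\<in>F. (cmod (c i j))\<^sup>2))"
  proof (rule eventually_finite_subsets_at_top_weakI)
    fix F assume F: "finite F" "F \<subseteq> Sigma I \<sigma>"
    have tr: "truncation F c \<in> l2_sum I \<sigma>"
      by (rule truncation_in_l2_sum[OF finite_I F])
    have "T (\<lambda>i j. c i j + (-1) * truncation F c i j) = T c + scaleC (-1) (T (truncation F c))"
      by (simp only: T_add[OF c l2_sum_scale[OF tr]] T_scale[OF tr])
    also have "\<dots> = T c - (\<Sum>(i, j)\<in>F. scaleC (c i j) (f i j))"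
      using scaleR_scaleC[of "-1" "T (truncation F c)"] by (simp add: T_truncation[OF F])
    finally show "norm ((\<Sum>(i, j)\<in>F. scaleC (c i j) (f i j)) - T c)
        \<le> C * sqrt (L - (\<Sum>(i, j)\<in>F. (cmod (c i j))\<^sup>2))"
      using C[OF l2_norm_diff_truncation(1)[OF finite_I F c]]
      unfolding l2_norm_diff_truncation(2)[OF finite_I F c] L_def
      by (simp only: norm_minus_commute)
  qed
  from Lim_null_comparison[OF this lim] show ?thesis
    unfolding has_sum_def by (rule Lim_null[THEN iffD2])
qed

lemma analysis_in_l2_sum: "analysis I \<sigma> f x \<in> l2_sum I \<sigma>"
proof -
  obtain C where "bessel_bound C (Sigma I \<sigma>) (\<lambda>(i, j). f i j)"
    by (rule bessel)
  from bessel_bound_summable(1)[OF this, of x]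
  have "(\<lambda>(i, j). (cmod (analysis I \<sigma> f x i j))\<^sup>2) summable_on Sigma I \<sigma>"
    by (rule summable_on_cong[THEN iffD1, rotated]) (auto simp: analysis_def)
  then show ?thesis
    unfolding l2_sum_iff[OF finite_I] by (auto simp: analysis_def)
qed

text \<open>The functional given by pairing with \<open>x\<close> is continuous and can be applied
  to the series for \<open>T c\<close> term by term.\<close>

lemma cinner_T:
  assumes c: "c \<in> l2_sum I \<sigma>"
  shows "cinner (T c) x = l2_inner I \<sigma> c (analysis I \<sigma> f x)"
proof -
  have "((\<lambda>k. cinner (case k of (i, j) \<Rightarrow> scaleC (c i j) (f i j)) x) has_sum cinner (T c) x) (Sigma I \<sigma>)"
    by (rule has_sum_bounded_linear[OF bounded_linear_cinner_left T_has_sum[OF c]])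
  then have "((\<lambda>(i, j). c i j * cnj (analysis I \<sigma> f x i j)) has_sum cinner (T c) x) (Sigma I \<sigma>)"
    by (rule has_sum_cong[THEN iffD1, rotated])
      (auto simp: analysis_def cinner_scaleC_left simp flip: cinner_commute)
  then show ?thesis
    unfolding l2_inner_eq_infsum[OF finite_I c analysis_in_l2_sum] by (simp add: infsumI)
qed

lemma l2_inner_basis:
  assumes ij: "i \<in> I" "j \<in> \<sigma> i" and d: "d \<in> l2_sum I \<sigma>"
  shows "l2_basis i j \<in> l2_sum I \<sigma>" and "l2_inner I \<sigma> (l2_basis i j) d = cnj (d i j)"
proof -
  show b: "l2_basis i j \<in> l2_sum I \<sigma>"
    unfolding l2_basis_eq_truncation using ij by (intro truncation_in_l2_sum finite_I) auto
  have "((\<lambda>(i', j'). l2_basis i j i' j' * cnj (d i' j')) has_sum cnj (d i j)) (Sigma I \<sigma>)"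
    using ij by (intro has_sum_finite_neutralI[of "{(i, j)}"]) (auto simp: l2_basis_def split: if_splits)
  then show "l2_inner I \<sigma> (l2_basis i j) d = cnj (d i j)"
    unfolding l2_inner_eq_infsum[OF finite_I b d] by (rule infsumI)
qed

text \<open>Existence is \<open>cinner_T\<close>. For uniqueness, testing against a basis vector
  reads off each coordinate in the index set, and off it both sides are zero.\<close>

lemma l2_adjoint_eq_analysis: "l2_adjoint I \<sigma> T = analysis I \<sigma> f"
  unfolding l2_adjoint_def
proof (rule the_equality)
  fix S assume S: "(\<forall>x. S x \<in> l2_sum I \<sigma>) \<and>
    (\<forall>c\<in>l2_sum I \<sigma>. \<forall>x. cinner (T c) x = l2_inner I \<sigma> c (S x))"
  show "S = analysis I \<sigma> f"
  proof (intro ext)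
    fix x i j
    show "S x i j = analysis I \<sigma> f x i j"
    proof (cases "i \<in> I \<and> j \<in> \<sigma> i")
      case True
      then have "cnj (S x i j) = cinner (T (l2_basis i j)) x"
        using S l2_inner_basis[of i j "S x"] by metis
      then show ?thesis
        using True by (simp add: analysis_def T_basis cinner_commute[of x])
          (metis complex_cnj_cnj)
    next
      case False
      then show ?thesis
        using S unfolding l2_sum_def analysis_def by auto
    qed
  qed
qed (simp add: analysis_in_l2_sum cinner_T)

section \<open>The frame operator, composed of T and its adjoint\<close>

lemma cinner_frame_operator:
  "cinner (T (l2_adjoint I \<sigma> T x)) y = l2_inner I \<sigma> (analysis I \<sigma> f x) (analysis I \<sigma> f y)"
  by (simp add: l2_adjoint_eq_analysis cinner_T analysis_in_l2_sum)

lemma l2_norm_analysis: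
  "l2_norm I \<sigma> (analysis I \<sigma> f x) = sqrt (\<Sum>\<^sub>\<infinity>(i, j)\<in>Sigma I \<sigma>. (cmod (cinner x (f i j)))\<^sup>2)"
  unfolding l2_norm_eq_infsum[OF finite_I analysis_in_l2_sum]
  by (intro arg_cong[where f = sqrt] infsum_cong) (auto simp: analysis_def)

text \<open>Both sides are the squared norm of the analysis coefficients; equality of the square
  roots suffices, as \<open>sqrt\<close> is injective on all reals.\<close>

lemma Re_cinner_frame_operator:
  "Re (cinner (T (l2_adjoint I \<sigma> T x)) x) = (\<Sum>\<^sub>\<infinity>(i, j)\<in>Sigma I \<sigma>. (cmod (cinner x (f i j)))\<^sup>2)"
  using l2_norm_analysis[of x] unfolding cinner_frame_operator l2_norm_def by simp

lemma selfadjoint_frame_operator: "selfadjoint_operator (\<lambda>x. T (l2_adjoint I \<sigma> T x))"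
  unfolding selfadjoint_operator_def
proof (intro conjI allI)
  obtain C where C: "C \<ge> 0" "\<And>c. c \<in> l2_sum I \<sigma> \<Longrightarrow> norm (T c) \<le> C * l2_norm I \<sigma> c"
    using T_bound by blast
  obtain D where D: "bessel_bound D (Sigma I \<sigma>) (\<lambda>(i, j). f i j)"
    by (rule bessel)
  have scale: "T (l2_adjoint I \<sigma> T (scaleC a x)) = scaleC a (T (l2_adjoint I \<sigma> T x))" for a x
  proof -
    have "analysis I \<sigma> f (scaleC a x) = (\<lambda>i j. a * analysis I \<sigma> f x i j)"
      by (auto simp: analysis_def cinner_scaleC_left fun_eq_iff)
    then show ?thesis
      by (simp add: l2_adjoint_eq_analysis T_scale[OF analysis_in_l2_sum])
  qed
  then show "T (l2_adjoint I \<sigma> T (scaleC a x)) = scaleC a (T (l2_adjoint I \<sigma> T x))" for a x .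
  show "bounded_linear (\<lambda>x. T (l2_adjoint I \<sigma> T x))"
  \<comment> \<open>\<open>D\<close> bounds the analysis operator and \<open>C\<close> bounds
    \<open>T\<close>.\<close>
  proof (rule bounded_linear_intro[of _ "D * C"])
    fix x y :: 'h
    have "analysis I \<sigma> f (x + y) = (\<lambda>i j. analysis I \<sigma> f x i j + analysis I \<sigma> f y i j)"
      by (auto simp: analysis_def cinner_add_left fun_eq_iff)
    then show "T (l2_adjoint I \<sigma> T (x + y)) = T (l2_adjoint I \<sigma> T x) + T (l2_adjoint I \<sigma> T y)"
      by (simp add: l2_adjoint_eq_analysis T_add[OF analysis_in_l2_sum analysis_in_l2_sum])
    show "T (l2_adjoint I \<sigma> T (r *\<^sub>R x)) = r *\<^sub>R T (l2_adjoint I \<sigma> T x)" for r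
      by (simp add: scaleR_scaleC scale)
    have "norm (T (analysis I \<sigma> f x)) \<le> C * l2_norm I \<sigma> (analysis I \<sigma> f x)"
      by (rule C(2)[OF analysis_in_l2_sum])
    also have "\<dots> \<le> C * (D * norm x)"
      using bessel_bound_summable(2)[OF D, of x] D C(1) unfolding l2_norm_analysis
      by (intro mult_left_mono real_le_lsqrt) (auto simp: bessel_bound_def case_prod_beta')
    finally show "norm (T (l2_adjoint I \<sigma> T x)) \<le> norm x * (D * C)"
      by (simp add: l2_adjoint_eq_analysis algebra_simps)
  qed
  fix x y
  have "cnj (l2_inner I \<sigma> (analysis I \<sigma> f y) (analysis I \<sigma> f x))
      = l2_inner I \<sigma> (analysis I \<sigma> f x) (analysis I \<sigma> f y)"
    unfolding l2_inner_def by (simp add: mult.commute flip: infsum_cnj)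
  then show "cinner (T (l2_adjoint I \<sigma> T x)) y = cinner x (T (l2_adjoint I \<sigma> T y))"
    by (simp add: cinner_frame_operator cinner_commute[of x])
qed

text \<open>Both operators are self-adjoint, so the order reduces to a comparison of quadratic
  forms, which is the lower frame inequality.\<close>

lemma operator_le_frame_operator_iff:
  "operator_le (\<lambda>x. A *\<^sub>R x) (\<lambda>x. T (l2_adjoint I \<sigma> T x)) \<longleftrightarrow>
    (\<forall>x. A * (norm x)\<^sup>2 \<le> (\<Sum>\<^sub>\<infinity>(i, j)\<in>Sigma I \<sigma>. (cmod (cinner x (f i j)))\<^sup>2))"
proof -
  have "selfadjoint_operator (\<lambda>x :: 'h. A *\<^sub>R x)"
    unfolding selfadjoint_operator_def
    by (auto simp: bounded_linear_scaleR_right scaleR_scaleC_commute cinner_scaleR_left cinner_scaleR_right)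
  then show ?thesis
    unfolding operator_le_def
    by (simp add: selfadjoint_frame_operator Re_cinner_frame_operator cinner_scaleR_left cinner_self)
qed

end

section \<open>Woven frames\<close>

lemma frame_imp_operator:
  fixes f :: "'i \<Rightarrow> 'j \<Rightarrow> 'h::chilbert_space"
  assumes I: "finite I" and fr: "frame_with_bounds A B (Sigma I \<sigma>) (\<lambda>(i, j). f i j)"
  shows "\<exists>T. l2_bounded_operator I \<sigma> T \<and> (\<forall>i\<in>I. \<forall>j\<in>\<sigma> i. T (l2_basis i j) = f i j) \<and>
    operator_le (\<lambda>x. A *\<^sub>R x) (\<lambda>x. T (l2_adjoint I \<sigma> T x))"
proof -
  obtain T where T: "l2_bounded_operator I \<sigma> T" "\<forall>i\<in>I. \<forall>j\<in>\<sigma> i. T (l2_basis i j) = f i j"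
    using bessel_bound_imp_operator[OF I frame_with_bounds_imp_bessel[OF fr]] by blast
  interpret l2_operator I \<sigma> T f
    using I T by unfold_locales auto
  show ?thesis
    using T fr unfolding frame_with_bounds_def
    by (intro exI[of _ T]) (auto simp: operator_le_frame_operator_iff case_prod_beta')
qed

section \<open>From operators back to woven frames\<close>

lemma frame_with_boundsI_bessel:
  assumes "A > 0" "B > 0" "C\<^sup>2 \<le> B" "bessel_bound C K g"
    and "\<And>x. A * (norm x)\<^sup>2 \<le> (\<Sum>\<^sub>\<infinity>k\<in>K. (cmod (cinner x (g k)))\<^sup>2)"
  shows "frame_with_bounds A B K g"
  unfolding frame_with_bounds_def
proof (intro conjI allI)
  fix x
  have "(\<Sum>\<^sub>\<infinity>k\<in>K. (cmod (cinner x (g k)))\<^sup>2) \<le> (C * norm x)\<^sup>2"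
    by (rule bessel_bound_summable(2)[OF assms(4)])
  also have "\<dots> \<le> B * (norm x)\<^sup>2"
    using assms(3) by (simp add: power_mult_distrib mult_right_mono)
  finally show "(\<Sum>\<^sub>\<infinity>k\<in>K. (cmod (cinner x (g k)))\<^sup>2) \<le> B * (norm x)\<^sup>2" .
qed (use assms bessel_bound_summable(1)[OF assms(4)] in auto)

text \<open>A finite \<open>F\<close> splits into sections \<open>G i\<close>, each contained in
  \<open>J\<close>, and the squared bounds add. The resulting constant does not depend on
  \<open>\<sigma>\<close>, which is what a universal upper bound requires.\<close>

lemma bessel_bound_Sigma:
  assumes I: "finite I" and C: "\<And>i. i \<in> I \<Longrightarrow> bessel_bound (C i) J (f i)"
    and \<sigma>: "\<And>i. i \<in> I \<Longrightarrow> \<sigma> i \<subseteq> J"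
  shows "bessel_bound (sqrt (\<Sum>i\<in>I. (C i)\<^sup>2)) (Sigma I \<sigma>) (\<lambda>(i, j). f i j)"
  unfolding bessel_bound_def
proof (intro conjI allI impI)
  have nn: "0 \<le> (\<Sum>i\<in>I. (C i)\<^sup>2)" by (simp add: sum_nonneg)
  then show "0 \<le> sqrt (\<Sum>i\<in>I. (C i)\<^sup>2)" by simp
  fix F and x :: 'c
  assume F: "finite F \<and> F \<subseteq> Sigma I \<sigma>"
  define G where "G i = {j. (i, j) \<in> F}" for i
  have G: "finite (G i)" for i
    unfolding G_def by (rule finite_subset[of _ "snd ` F"]) (use F in \<open>auto intro: rev_image_eqI\<close>)
  have GJ: "G i \<subseteq> J" if "i \<in> I" for i
    using F \<sigma>[OF that] by (auto simp: G_def)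
  have "F = Sigma I G"
    using F by (auto simp: G_def)
  then have "(\<Sum>k\<in>F. (cmod (cinner x (case k of (i, j) \<Rightarrow> f i j)))\<^sup>2)
      = (\<Sum>i\<in>I. \<Sum>j\<in>G i. (cmod (cinner x (f i j)))\<^sup>2)"
    using I G by (simp add: sum.Sigma case_prod_beta')
  also have "\<dots> \<le> (\<Sum>i\<in>I. (C i * norm x)\<^sup>2)"
    using C G GJ by (intro sum_mono) (auto simp: bessel_bound_def)
  also have "\<dots> = (sqrt (\<Sum>i\<in>I. (C i)\<^sup>2) * norm x)\<^sup>2"
    using nn by (simp add: power_mult_distrib sum_distrib_right)
  finally show "(\<Sum>k\<in>F. (cmod (cinner x (case k of (i, j) \<Rightarrow> f i j)))\<^sup>2)
      \<le> (sqrt (\<Sum>i\<in>I. (C i)\<^sup>2) * norm x)\<^sup>2" .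
qed

lemma operators_imp_woven:
  fixes f :: "'i \<Rightarrow> 'j \<Rightarrow> 'h::chilbert_space"
  assumes I: "finite I" and A: "A > 0"
    and T: "\<And>\<sigma>. is_partition I J \<sigma> \<Longrightarrow>
      \<exists>T. l2_bounded_operator I \<sigma> T \<and> (\<forall>i\<in>I. \<forall>j\<in>\<sigma> i. T (l2_basis i j) = f i j) \<and>
        operator_le (\<lambda>x. A *\<^sub>R x) (\<lambda>x. T (l2_adjoint I \<sigma> T x))"
  shows "woven_frames I J f"
proof -
  \<comment> \<open>The lower bound is uniform, but the Bessel constant obtained here may vary with
    the partition.\<close>
  have bnd: "(\<forall>x. A * (norm x)\<^sup>2 \<le> (\<Sum>\<^sub>\<infinity>(i, j)\<in>Sigma I \<sigma>. (cmod (cinner x (f i j)))\<^sup>2)) \<and>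
      (\<exists>C. bessel_bound C (Sigma I \<sigma>) (\<lambda>(i, j). f i j))" if \<sigma>: "is_partition I J \<sigma>" for \<sigma>
  proof -
    obtain T where T: "l2_bounded_operator I \<sigma> T" "\<forall>i\<in>I. \<forall>j\<in>\<sigma> i. T (l2_basis i j) = f i j"
        "operator_le (\<lambda>x. A *\<^sub>R x) (\<lambda>x. T (l2_adjoint I \<sigma> T x))"
      using T[OF \<sigma>] by blast
    interpret l2_operator I \<sigma> T f
      using I T by unfold_locales auto
    show ?thesis
      using T(3) bessel unfolding operator_le_frame_operator_iff by metis
  qed
  have single: "(\<forall>x. A * (norm x)\<^sup>2 \<le> (\<Sum>\<^sub>\<infinity>j\<in>J. (cmod (cinner x (f i j)))\<^sup>2)) \<and>
      (\<exists>C. bessel_bound C J (f i))" if i: "i \<in> I" for i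
  proof -
    define \<sigma> where "\<sigma> i' = (if i' = i then J else {})" for i'
    have "is_partition I J \<sigma>"
      using i by (auto simp: is_partition_def \<sigma>_def disjoint_family_on_def)
    note b = bnd[OF this]
    \<comment> \<open>For this partition the index set is a copy of \<open>J\<close>, and both
      bounds are transported along the injection \<open>Pair i\<close>.\<close>
    have S: "Sigma I \<sigma> = Pair i ` J"
      using i by (auto simp: \<sigma>_def split: if_splits)
    have inj: "inj_on (Pair i) J'" for J' :: "'j set"
      by (rule inj_onI) simp
    obtain C where C: "bessel_bound C (Pair i ` J) (\<lambda>(i, j). f i j)"
      using b unfolding S by blast
    have "bessel_bound C J (f i)"
      unfolding bessel_bound_def
    proof (intro conjI allI impI)
      fix F and x :: 'h
      assume F: "finite F \<and> F \<subseteq> J"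
      have "(\<Sum>k\<in>Pair i ` F. (cmod (cinner x (case k of (i, j) \<Rightarrow> f i j)))\<^sup>2) \<le> (C * norm x)\<^sup>2"
        using C F unfolding bessel_bound_def by (metis finite_imageI image_mono)
      then show "(\<Sum>j\<in>F. (cmod (cinner x (f i j)))\<^sup>2) \<le> (C * norm x)\<^sup>2"
        by (simp add: sum.reindex[OF inj])
    qed (use C in \<open>simp add: bessel_bound_def\<close>)
    then show ?thesis
      using b unfolding S infsum_reindex[OF inj] by (auto simp: comp_def)
  qed
  then obtain C where C: "\<And>i. i \<in> I \<Longrightarrow> bessel_bound (C i) J (f i)"
    by metis
  have "is_frame J (f i)" if "i \<in> I" for i
    unfolding is_frame_def
  proof (intro exI)
    \<comment> \<open>Adding 1 keeps the upper bound positive when \<open>C i\<close> is 0; the same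
      is done for \<open>B\<close> below, where the sum may also be empty.\<close>
    show "frame_with_bounds A ((C i)\<^sup>2 + 1) J (f i)"
      using A C[OF that] single[OF that] by (intro frame_with_boundsI_bessel[where C = "C i"])
        (auto simp: add_nonneg_pos)
  qed
  moreover define B where "B = (\<Sum>i\<in>I. (C i)\<^sup>2) + 1"
  have "frame_with_bounds A B (Sigma I \<sigma>) (\<lambda>(i, j). f i j)" if \<sigma>: "is_partition I J \<sigma>" for \<sigma>
  proof (rule frame_with_boundsI_bessel)
    show "bessel_bound (sqrt (\<Sum>i\<in>I. (C i)\<^sup>2)) (Sigma I \<sigma>) (\<lambda>(i, j). f i j)"
      using \<sigma> C by (intro bessel_bound_Sigma[OF I, of C J]) (auto simp: is_partition_def)
    show "A * (norm x)\<^sup>2 \<le> (\<Sum>\<^sub>\<infinity>k\<in>Sigma I \<sigma>. (cmod (cinner x (case k of (i, j) \<Rightarrow> f i j)))\<^sup>2)" for x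
      using bnd[OF \<sigma>] by (simp add: case_prod_beta')
  qed (use A in \<open>auto simp: B_def sum_nonneg add_nonneg_pos\<close>)
  moreover have "B > 0"
    by (auto simp: B_def intro!: add_nonneg_pos sum_nonneg)
  ultimately show ?thesis
    using A unfolding woven_frames_def by blast
qed

theorem theorem2p3:
  fixes m :: nat and J :: "'j set" and f :: "nat \<Rightarrow> 'j \<Rightarrow> 'h::chilbert_space"
  assumes "separable_space (euclidean :: 'h topology)"
    and "countable J"
  shows "woven_frames {1..m} J f \<longleftrightarrow>
    (\<exists>A>0. \<forall>\<sigma>. is_partition {1..m} J \<sigma> \<longrightarrow>
      (\<exists>T. l2_bounded_operator {1..m} \<sigma> T \<and>
           (\<forall>i\<in>{1..m}. \<forall>j\<in>\<sigma> i. T (l2_basis i j) = f i j) \<and>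
           operator_le (\<lambda>x. A *\<^sub>R x) (\<lambda>x. T (l2_adjoint {1..m} \<sigma> T x))))"
proof
  assume "woven_frames {1..m} J f"
  then obtain A B where "A > 0" and
      "\<And>\<sigma>. is_partition {1..m} J \<sigma> \<Longrightarrow> frame_with_bounds A B (Sigma {1..m} \<sigma>) (\<lambda>(i, j). f i j)"
    unfolding woven_frames_def by blast
  then show "\<exists>A>0. \<forall>\<sigma>. is_partition {1..m} J \<sigma> \<longrightarrow>
      (\<exists>T. l2_bounded_operator {1..m} \<sigma> T \<and>
           (\<forall>i\<in>{1..m}. \<forall>j\<in>\<sigma> i. T (l2_basis i j) = f i j) \<and>
           operator_le (\<lambda>x. A *\<^sub>R x) (\<lambda>x. T (l2_adjoint {1..m} \<sigma> T x)))"
    using frame_imp_operator[OF finite_atLeastAtMost] by blast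
next
  assume "\<exists>A>0. \<forall>\<sigma>. is_partition {1..m} J \<sigma> \<longrightarrow>
      (\<exists>T. l2_bounded_operator {1..m} \<sigma> T \<and>
           (\<forall>i\<in>{1..m}. \<forall>j\<in>\<sigma> i. T (l2_basis i j) = f i j) \<and>
           operator_le (\<lambda>x. A *\<^sub>R x) (\<lambda>x. T (l2_adjoint {1..m} \<sigma> T x)))"
  then obtain A where "A > 0" and "\<And>\<sigma>. is_partition {1..m} J \<sigma> \<Longrightarrow>
      \<exists>T. l2_bounded_operator {1..m} \<sigma> T \<and>
           (\<forall>i\<in>{1..m}. \<forall>j\<in>\<sigma> i. T (l2_basis i j) = f i j) \<and>
           operator_le (\<lambda>x. A *\<^sub>R x) (\<lambda>x. T (l2_adjoint {1..m} \<sigma> T x))"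
    by blast
  then show "woven_frames {1..m} J f"
    by (rule operators_imp_woven[OF finite_atLeastAtMost])
qed

end
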